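(* Let $(X,\tau)$ and $(Y,\sigma)$ be Hausdorff locally convex spaces over $\mathbb{K}$, with topologies generated by families of seminorms $\{\rho_j\}_{j\in J}$ and $\{\sigma_i\}_{i\in I}$ respectively, and let $T:X\to Y$ be linear. Suppose that $G(T)=\{0\}$ and that the seminormed spaces $(X,\rho_j)$ and $(Y,\sigma_i)$ are complete for each $(j,i)\in J\times I$. Then the graph of $T$ is $(\tau\times\sigma)$-closed in $X\times Y$. Consequently, if $(X,\tau)$ and $(Y,\sigma)$ satisfy the assumptions of a closed graph theorem (that is, are such that every linear map $(X,\tau)\to(Y,\sigma)$ with closed graph is continuous), then $T:(X,\tau)\to(Y,\sigma)$ is continuous.
   Context: $\mathbb{K}$ is $\mathbb{R}$ or $\mathbb{C}$. $(X,\rho_j)$ denotes $X$ with the topology of the single seminorm $\rho_j$, similarly $(Y,\sigma_i)$; such a seminormed space is complete if every Cauchy sequence converges. For $j\in J$, $i\in I$, $$G_{ji}(T)=\{y\in Y:\ \exists (x_n)_{n\in\mathbb{N}}\subset X \text{ with } \rho_j(x_n)\to 0 \text{ and } \sigma_i(Tx_n-y)\to 0\},$$ and the separating space of $T$ is $G(T)=\bigcap_{(j,i)\in J\times I}G_{ji}(T)$. *)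

theory Defs
  imports "HOL-Analysis.Analysis"
begin

text \<open>
  The scalar field is the reals or the complex numbers.  A type class is used so that both cases are
  covered by one scalar type; its members are exactly the isometric copies of \<^typ>\<open>real\<close> and
  \<^typ>\<open>complex\<close>.
\<close>

class real_or_complex = real_normed_field +
  assumes real_or_complex:
    "(\<exists>\<phi> :: 'a \<Rightarrow> real. bij \<phi> \<and> (\<forall>a b. \<phi> (a + b) = \<phi> a + \<phi> b)
        \<and> (\<forall>a b. \<phi> (a * b) = \<phi> a * \<phi> b) \<and> (\<forall>a. norm (\<phi> a) = norm a))
   \<or> (\<exists>\<phi> :: 'a \<Rightarrow> complex. bij \<phi> \<and> (\<forall>a b. \<phi> (a + b) = \<phi> a + \<phi> b)
        \<and> (\<forall>a b. \<phi> (a * b) = \<phi> a * \<phi> b) \<and> (\<forall>a. norm (\<phi> a) = norm a))"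

instance real :: real_or_complex
  by standard (rule disjI1, rule exI[of _ id], simp)

instance complex :: real_or_complex
  by standard (rule disjI2, rule exI[of _ id], simp)

definition seminorm :: "('k::real_normed_field \<Rightarrow> 'a::ab_group_add \<Rightarrow> 'a) \<Rightarrow> ('a \<Rightarrow> real) \<Rightarrow> bool"
  where "seminorm scl p \<longleftrightarrow>
    (\<forall>x. 0 \<le> p x) \<and>
    (\<forall>x y. p (x + y) \<le> p x + p y) \<and>
    (\<forall>c x. p (scl c x) = norm c * p x)"

text \<open>
  The whole space is put into the subbasis because \<^const>\<open>topology_generated_by\<close> takes the
  union of the subbasis as its underlying set, which would be empty for an empty family.
\<close>

definition seminorm_topology :: "'j set \<Rightarrow> ('j \<Rightarrow> 'a::ab_group_add \<Rightarrow> real) \<Rightarrow> 'a topology"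
  where "seminorm_topology J \<rho> =
    topology_generated_by (insert UNIV {{y. \<rho> j (y - x) < e} | j x e. j \<in> J \<and> 0 < e})"

lemma topspace_seminorm_topology [simp]: "topspace (seminorm_topology J \<rho>) = UNIV"
  by (simp add: seminorm_topology_def)

locale hausdorff_lcs = vector_space scl
  for scl :: "'k::real_or_complex \<Rightarrow> 'a::ab_group_add \<Rightarrow> 'a" +
  fixes J :: "'j set" and \<rho> :: "'j \<Rightarrow> 'a \<Rightarrow> real" and \<tau> :: "'a topology"
  assumes seminorms: "\<And>j. j \<in> J \<Longrightarrow> seminorm scl (\<rho> j)"
    and topology_eq: "\<tau> = seminorm_topology J \<rho>"
    and Hausdorff: "Hausdorff_space \<tau>"

definition seminorm_complete :: "('a::ab_group_add \<Rightarrow> real) \<Rightarrow> bool"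
  where "seminorm_complete p \<longleftrightarrow>
    (\<forall>u :: nat \<Rightarrow> 'a.
      (\<forall>e>0. \<exists>N. \<forall>m\<ge>N. \<forall>n\<ge>N. p (u m - u n) < e) \<longrightarrow>
      (\<exists>x. (\<lambda>n. p (u n - x)) \<longlonglongrightarrow> 0))"

definition separating_component ::
    "('a \<Rightarrow> real) \<Rightarrow> ('b::ab_group_add \<Rightarrow> real) \<Rightarrow> ('a \<Rightarrow> 'b) \<Rightarrow> 'b set"
  where "separating_component p q T =
    {y. \<exists>x :: nat \<Rightarrow> 'a. (\<lambda>n. p (x n)) \<longlonglongrightarrow> 0 \<and> (\<lambda>n. q (T (x n) - y)) \<longlonglongrightarrow> 0}"

definition separating_space ::
    "'j set \<Rightarrow> ('j \<Rightarrow> 'a \<Rightarrow> real) \<Rightarrow> 'i set \<Rightarrow> ('i \<Rightarrow> 'b::ab_group_add \<Rightarrow> real) \<Rightarrow> ('a \<Rightarrow> 'b) \<Rightarrow> 'b set"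
  where "separating_space J \<rho> I \<sigma> T = (\<Inter>(j, i)\<in>J \<times> I. separating_component (\<rho> j) (\<sigma> i) T)"

definition fun_graph :: "('a \<Rightarrow> 'b) \<Rightarrow> ('a \<times> 'b) set"
  where "fun_graph T = {(x, y). y = T x}"

end

theory Submission
  imports Defs
begin

text \<open>
  If \<open>z = y - T x\<close> is nonzero, then it lies outside some \<open>G\<^sub>j\<^sub>i(T)\<close>, which gives an \<open>\<epsilon> > 0\<close> such that no \<open>u\<close>
  satisfies both \<open>\<rho>\<^sub>j(u) < \<epsilon>\<close> and \<open>\<sigma>\<^sub>i(T u - z) < \<epsilon>\<close>.  Translating by \<open>(x, T x)\<close>, the product of the
  \<open>\<epsilon>\<close>-balls around \<open>x\<close> and \<open>y\<close> misses the graph.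
\<close>

lemma seminorm_zero:
  assumes "seminorm scl p" and "vector_space scl"
  shows "p 0 = 0"
proof -
  interpret vector_space scl by fact
  have "p (scl 0 0) = norm (0 :: 'a) * p 0"
    using assms(1) unfolding seminorm_def by blast
  then show ?thesis by simp
qed

lemma openin_seminorm_ball:
  assumes "j \<in> J" and "0 < e"
  shows "openin (seminorm_topology J \<rho>) {y. \<rho> j (y - x) < e}"
  unfolding seminorm_topology_def
  by (rule topology_generated_by_Basis) (use assms in blast)

text \<open>If no \<open>e\<close> worked, each \<open>e\<close> = 1/(n+1) would fail at some point
  \<open>x n\<close>, and these points would form a sequence putting \<open>y\<close> into the
  component. This trades a condition on sequences for one positive radius, the form in which balls
  of the topology can use it.\<close>

lemma not_in_separating_component:
  assumes "y \<notin> separating_component p q T"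
    and p: "\<And>x. 0 \<le> p x" and q: "\<And>y. 0 \<le> q y"
  obtains e where "0 < e" and "\<And>x. p x < e \<Longrightarrow> \<not> q (T x - y) < e"
proof (rule ccontr)
  note witness = that
  assume "\<not> thesis"
  then have "\<exists>x. p x < e \<and> q (T x - y) < e" if "0 < e" for e
    using that witness by blast
  then have "\<forall>n. \<exists>x. p x < inverse (real (Suc n)) \<and> q (T x - y) < inverse (real (Suc n))"
    by (metis inverse_positive_iff_positive of_nat_0_less_iff zero_less_Suc)
  then obtain x where x: "\<And>n. p (x n) < inverse (real (Suc n))"
      "\<And>n. q (T (x n) - y) < inverse (real (Suc n))"
    by metis
  \<comment> \<open>Both sequences are squeezed between 0, by nonnegativity of \<open>p\<close> and
    \<open>q\<close>, and 1/(n+1).\<close>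
  have "(\<lambda>n. p (x n)) \<longlonglongrightarrow> 0" "(\<lambda>n. q (T (x n) - y)) \<longlonglongrightarrow> 0"
    by (rule real_tendsto_sandwich[OF _ _ tendsto_const LIMSEQ_inverse_real_of_nat];
        simp add: p q x less_imp_le del: of_nat_Suc)+
  then show False
    using assms(1) unfolding separating_component_def by blast
qed

lemma closedin_fun_graph:
  fixes T :: "'a::ab_group_add \<Rightarrow> 'b::ab_group_add"
  assumes X: "hausdorff_lcs scaleX J \<rho> \<tau>"
    and Y: "hausdorff_lcs scaleY I \<sigma>s \<sigma>"
    and T: "Vector_Spaces.linear scaleX scaleY T"
    and G: "separating_space J \<rho> I \<sigma>s T = {0}"
  shows "closedin (prod_topology \<tau> \<sigma>) (fun_graph T)"
proof -
  interpret X: hausdorff_lcs scaleX J \<rho> \<tau> by fact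
  interpret Y: hausdorff_lcs scaleY I \<sigma>s \<sigma> by fact
  interpret T: Vector_Spaces.linear scaleX scaleY T by fact
  have top: "topspace (prod_topology \<tau> \<sigma>) = UNIV"
    by (simp add: X.topology_eq Y.topology_eq)
  have "\<exists>U. openin (prod_topology \<tau> \<sigma>) U \<and> w \<in> U \<and> U \<subseteq> - fun_graph T"
    if w: "w \<in> - fun_graph T" for w
  proof -
    obtain x y where xy: "w = (x, y)" "y - T x \<noteq> 0"
      using w by (cases w) (auto simp: fun_graph_def)
    then have "y - T x \<notin> separating_space J \<rho> I \<sigma>s T"
      using G by simp
    then obtain j i where ji: "j \<in> J" "i \<in> I"
        and out: "y - T x \<notin> separating_component (\<rho> j) (\<sigma>s i) T"
      by (auto simp: separating_space_def)
    note sn = X.seminorms[OF ji(1)] Y.seminorms[OF ji(2)]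
    obtain e where e: "0 < e" "\<And>u. \<rho> j u < e \<Longrightarrow> \<not> \<sigma>s i (T u - (y - T x)) < e"
      using not_in_separating_component[OF out] sn unfolding seminorm_def by metis
    let ?U = "{a. \<rho> j (a - x) < e} \<times> {b. \<sigma>s i (b - y) < e}"
    have "openin (prod_topology \<tau> \<sigma>) ?U"
      using ji e(1)
      by (simp add: openin_prod_Times_iff X.topology_eq Y.topology_eq openin_seminorm_ball)
    \<comment> \<open>The centres lie in their balls because seminorms vanish at 0.\<close>
    moreover have "w \<in> ?U"
      using e(1) seminorm_zero[OF sn(1) X.vector_space_axioms]
        seminorm_zero[OF sn(2) Y.vector_space_axioms] by (simp add: xy(1))
    moreover have "?U \<subseteq> - fun_graph T"
    proof -
      \<comment> \<open>Take \<open>u = a - x\<close> in the choice of \<open>e\<close>: by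
        linearity \<open>T (a - x) - (y - T x)\<close> equals \<open>T a - y\<close>, so no graph
        point over the first ball has its second coordinate in the second ball.\<close>
      have "\<not> \<sigma>s i (T a - y) < e" if "\<rho> j (a - x) < e" for a
        using e(2)[OF that] by (simp add: T.diff)
      then show ?thesis
        by (auto simp: fun_graph_def)
    qed
    ultimately show ?thesis by blast
  qed
  then have "openin (prod_topology \<tau> \<sigma>) (- fun_graph T)"
    by (subst openin_subopen) blast
  then show ?thesis
    by (simp add: closedin_def top Compl_eq_Diff_UNIV del: topspace_prod_topology)
qed

theorem theorem3p1:
  fixes scaleX :: "'k::real_or_complex \<Rightarrow> 'a::ab_group_add \<Rightarrow> 'a"
    and scaleY :: "'k \<Rightarrow> 'b::ab_group_add \<Rightarrow> 'b"
    and J :: "'j set" and \<rho> :: "'j \<Rightarrow> 'a \<Rightarrow> real" and \<tau> :: "'a topology"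
    and I :: "'i set" and \<sigma>s :: "'i \<Rightarrow> 'b \<Rightarrow> real" and \<sigma> :: "'b topology"
    and T :: "'a \<Rightarrow> 'b"
  assumes "hausdorff_lcs scaleX J \<rho> \<tau>"
    and "hausdorff_lcs scaleY I \<sigma>s \<sigma>"
    and "Vector_Spaces.linear scaleX scaleY T"
    and "separating_space J \<rho> I \<sigma>s T = {0}"
    and "\<And>j i. (j, i) \<in> J \<times> I \<Longrightarrow> seminorm_complete (\<rho> j) \<and> seminorm_complete (\<sigma>s i)"
  shows "closedin (prod_topology \<tau> \<sigma>) (fun_graph T) \<and>
    ((\<forall>S. Vector_Spaces.linear scaleX scaleY S \<and> closedin (prod_topology \<tau> \<sigma>) (fun_graph S)
          \<longrightarrow> continuous_map \<tau> \<sigma> S)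
      \<longrightarrow> continuous_map \<tau> \<sigma> T)"
  \<comment> \<open>The continuity claim is the closed graph hypothesis at
    \<open>S = T\<close>.\<close>
  using closedin_fun_graph[OF assms(1-4)] assms(3) by blast

end
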